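(* Let $S\subset\mathbb{C}^n$ be a generic subspace, $v^j,v^k$ two linearly independent principal standard vectors of $S$, $m_S$ the moment of $S$, and let $v^{j\curvearrowright k}$ be the curve defined in the context. Let $\gamma_{j,k}:[0,\pi/2]\to m_S\subset\mathbb{R}^n_{\ge0}$ be the curve $$\gamma_{j,k}(t)=|v^{j\curvearrowright k}(t)|^2=\big(|v^{j\curvearrowright k}_1(t)|^2,\dots,|v^{j\curvearrowright k}_n(t)|^2\big).$$ Then: 1. The projection to the $j$-th and $k$-th coordinates of $\sqrt{\gamma_{j,k}}$ (entrywise square root), given by $t\mapsto(|v^{j\curvearrowright k}_j(t)|,|v^{j\curvearrowright k}_k(t)|)\in\mathbb{R}^2$, is part of an ellipse centred at the origin. 2. If $v^j$ and $v^k$ are not orthogonal, the points $(|v^{j\curvearrowright k}_j(t)|^2,|v^{j\curvearrowright k}_k(t)|^2)$, $t\in[0,\pi/2]$, of the projection of the curve $\gamma_{j,k}$ to the plane spanned by $e_j,e_k$ are all extreme points of the projection of $m_S$ to the same plane. 3. If $v^j\perp v^k$, then $(|v^{j\curvearrowright k}_j(t)|^2,|v^{j\curvearrowright k}_k(t)|^2)$ parametrizes a segment that is contained in the boundary of the projection of $m_S$ to the plane spanned by $e_j,e_k$.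
   Context: Fix an orthonormal basis $E=\{e_1,\dots,e_n\}$ of $\mathbb{C}^n$; the inner product is linear in the first variable. For $x\in\mathbb{C}^n$, $x_i=\langle x,e_i\rangle$ and $|x|^2=(|x_1|^2,\dots,|x_n|^2)$. For a subspace $S$ ($\{0\}\subsetneq S\subsetneq\mathbb{C}^n$) with orthogonal projection $P_S$, the moment is $m_S=\operatorname{conv}\{|v|^2:v\in S,\ \|v\|=1\}$. $S$ is generic (with respect to $E$) if for every $i$ there is $x\in S$ with $x_i\ne0$; equivalently $P_Se_i\neq0$ for all $i$. The principal standard vectors of $S$ are $v^i=P_Se_i/\|P_Se_i\|\in S$, $i=1,\dots,n$, with coordinates $v^i_l=\langle v^i,e_l\rangle$. For $v^j,v^k$ linearly independent, $$v^{j\curvearrowright k}(t)=\cos(t)\,v^j+\sin(t)\,e^{i\arg(v^j_k)}\,\frac{v^k-\langle v^k,v^j\rangle v^j}{\|v^k-\langle v^k,v^j\rangle v^j\|},\quad t\in[0,\pi/2]$$ ($i$ in the exponent is the imaginary unit; $\arg(0)$ is taken to be $0$), and $v^{j\curvearrowright k}_l(t)=\langle v^{j\curvearrowright k}(t),e_l\rangle$. The projection to the plane spanned by $e_j,e_k$ is the map $\mathbb{R}^n\to\mathbb{R}^2$, $x\mapsto(x_j,x_k)$. *)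

theory Defs
  imports "HOL-Analysis.Analysis"
begin

text \<open>
  Complex subspaces of \<open>complex ^ 'n\<close> are expressed by \<open>vec.subspace\<close>; the unqualified
  \<open>subspace\<close> would only mean closure under real scalars.  Likewise the library's \<open>\<bullet>\<close> on
  \<open>complex ^ 'n\<close> is only the real part of the Hermitian inner product defined here.
\<close>

definition cinner :: "complex ^ 'n \<Rightarrow> complex ^ 'n \<Rightarrow> complex" where
  "cinner x y = (\<Sum>l\<in>UNIV. x $ l * cnj (y $ l))"

lemma cinner_self: "cinner x x = complex_of_real ((norm x)\<^sup>2)"
  unfolding cinner_def norm_vec_def L2_set_def
  by (simp add: complex_norm_square sum_nonneg flip: of_real_power)

definition orthonormal_basis :: "('n \<Rightarrow> complex ^ 'n) \<Rightarrow> bool" where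
  "orthonormal_basis e \<longleftrightarrow>
     (\<forall>i l. cinner (e i) (e l) = (if i = l then 1 else 0)) \<and> vec.span (range e) = UNIV"

text \<open>The family \<open>e\<close> in the definitions below is the fixed orthonormal basis of \<open>complex ^ 'n\<close>;
  \<open>e\<close> is indexed by the coordinate type itself.\<close>

definition coord :: "('n \<Rightarrow> complex ^ 'n) \<Rightarrow> complex ^ 'n \<Rightarrow> 'n \<Rightarrow> complex" where
  "coord e x i = cinner x (e i)"

definition abs_sq :: "('n \<Rightarrow> complex ^ 'n) \<Rightarrow> complex ^ 'n \<Rightarrow> real ^ 'n" where
  "abs_sq e x = (\<chi> i. (norm (coord e x i))\<^sup>2)"

definition orth_proj :: "(complex ^ 'n) set \<Rightarrow> complex ^ 'n \<Rightarrow> complex ^ 'n" where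
  "orth_proj S x = (THE p. p \<in> S \<and> (\<forall>y\<in>S. cinner (x - p) y = 0))"

definition moment :: "('n \<Rightarrow> complex ^ 'n) \<Rightarrow> (complex ^ 'n) set \<Rightarrow> (real ^ 'n) set" where
  "moment e S = convex hull {abs_sq e v | v. v \<in> S \<and> norm v = 1}"

definition generic :: "('n \<Rightarrow> complex ^ 'n) \<Rightarrow> (complex ^ 'n) set \<Rightarrow> bool" where
  "generic e S \<longleftrightarrow> (\<forall>i. \<exists>x\<in>S. coord e x i \<noteq> 0)"

definition principal_vec ::
    "('n \<Rightarrow> complex ^ 'n) \<Rightarrow> (complex ^ 'n) set \<Rightarrow> 'n \<Rightarrow> complex ^ 'n" where
  "principal_vec e S i = orth_proj S (e i) /\<^sub>R norm (orth_proj S (e i))"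

text \<open>The pair \<open>x, y\<close> is linearly independent as a family, so \<open>x = y\<close> is excluded.\<close>

definition lin_indep_pair :: "complex ^ 'n \<Rightarrow> complex ^ 'n \<Rightarrow> bool" where
  "lin_indep_pair x y \<longleftrightarrow> x \<noteq> y \<and> vec.independent {x, y}"

text \<open>The library's \<open>Arg\<close> satisfies \<open>Arg 0 = 0\<close>.\<close>

definition principal_curve ::
    "('n \<Rightarrow> complex ^ 'n) \<Rightarrow> (complex ^ 'n) set \<Rightarrow> 'n \<Rightarrow> 'n \<Rightarrow> real \<Rightarrow> complex ^ 'n" where
  "principal_curve e S j k t =
     (let vj = principal_vec e S j;
          vk = principal_vec e S k;
          w = vk - cinner vk vj *s vj
      in complex_of_real (cos t) *s vj
         + (complex_of_real (sin t) * exp (\<i> * complex_of_real (Arg (coord e vj k))))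
             *s (w /\<^sub>R norm w))"

definition moment_curve ::
    "('n \<Rightarrow> complex ^ 'n) \<Rightarrow> (complex ^ 'n) set \<Rightarrow> 'n \<Rightarrow> 'n \<Rightarrow> real \<Rightarrow> real ^ 'n" where
  "moment_curve e S j k t = abs_sq e (principal_curve e S j k t)"

definition plane_proj :: "'n \<Rightarrow> 'n \<Rightarrow> real ^ 'n \<Rightarrow> real \<times> real" where
  "plane_proj j k x = (x $ j, x $ k)"

text \<open>Nondegenerate, with arbitrary orthogonal axes \<open>u, w\<close> and semi-axes \<open>a, b\<close>; circles count.\<close>

definition centred_ellipse :: "(real \<times> real) set \<Rightarrow> bool" where
  "centred_ellipse C \<longleftrightarrow>
     (\<exists>a b u w. 0 < a \<and> 0 < b \<and> norm u = 1 \<and> norm w = 1 \<and> u \<bullet> w = 0 \<and>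
        C = {x. (x \<bullet> u)\<^sup>2 / a\<^sup>2 + (x \<bullet> w)\<^sup>2 / b\<^sup>2 = 1})"

end

theory Submission
  imports Defs
begin

text \<open>
  For \<open>x \<in> S\<close> the coordinate \<open>x\<^sub>i\<close> is \<open>r\<^sub>i\<close> times the inner product of \<open>x\<close> with
  \<open>v\<^sup>i\<close>, where \<open>r\<^sub>i\<close> is the norm of the projection of \<open>e\<^sub>i\<close>.  Splitting \<open>v\<^sup>k\<close>
  into a multiple of \<open>v\<^sup>j\<close> of modulus \<open>a\<close> and \<open>b\<close> times a unit vector \<open>u\<close> orthogonal to
  \<open>v\<^sup>j\<close>, Bessel's inequality bounds \<open>\<bar>x\<^sub>k\<bar>\<^sup>2\<close> for unit \<open>x\<close> by \<open>r\<^sub>k\<^sup>2\<close> times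
  \<open>a\<^sup>2 s + b\<^sup>2 (1 - s) + 2 a b sqrt (s (1 - s))\<close> with \<open>s = \<bar>x\<^sub>j\<bar>\<^sup>2 / r\<^sub>j\<^sup>2\<close>; along the curve
  the coordinates have moduli \<open>r\<^sub>j cos t\<close> and \<open>r\<^sub>k (a cos t + b sin t)\<close>, so the curve is the
  graph of this bound.  The bound is strictly concave if \<open>a > 0\<close>, hence all points of its graph are
  extreme in the hypograph; it is affine if \<open>a = 0\<close>.
\<close>

section \<open>The Hermitian inner product\<close>

lemma cinner_add_left: "cinner (x + y) z = cinner x z + cinner y z"
  by (simp add: cinner_def sum.distrib algebra_simps)

lemma cinner_add_right: "cinner x (y + z) = cinner x y + cinner x z"
  by (simp add: cinner_def sum.distrib algebra_simps)

lemma cinner_diff_left: "cinner (x - y) z = cinner x z - cinner y z"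
  by (simp add: cinner_def sum_subtractf algebra_simps)

lemma cinner_diff_right: "cinner x (y - z) = cinner x y - cinner x z"
  by (simp add: cinner_def sum_subtractf algebra_simps)

lemma cinner_scale_left: "cinner (c *s x) y = c * cinner x y"
  by (simp add: cinner_def sum_distrib_left algebra_simps)

lemma cinner_scale_right: "cinner x (c *s y) = cnj c * cinner x y"
  by (simp add: cinner_def sum_distrib_left algebra_simps)

lemma cnj_cinner: "cnj (cinner x y) = cinner y x"
  by (simp add: cinner_def mult.commute)

lemma Re_cinner: "Re (cinner x y) = x \<bullet> y"
  by (simp add: cinner_def inner_vec_def inner_complex_def)

lemmas cinner_simps = cinner_add_left cinner_add_right cinner_diff_left cinner_diff_right
  cinner_scale_left cinner_scale_right

lemma scaleR_eq_vec_scale: "r *\<^sub>R x = complex_of_real r *s (x :: complex ^ 'n)"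
  by (simp add: vec_eq_iff complex_eq_iff)

section \<open>Orthogonal projections and principal vectors\<close>

lemma complex_subspace_imp_subspace:
  fixes S :: "(complex ^ 'n) set"
  assumes "vec.subspace S"
  shows "subspace S"
  using assms by (simp add: subspace_def vec.subspace_def scaleR_eq_vec_scale)

lemma orth_proj_exists_unique:
  fixes S :: "(complex ^ 'n::finite) set"
  assumes S: "vec.subspace S"
  shows "\<exists>!p. p \<in> S \<and> (\<forall>y\<in>S. cinner (x - p) y = 0)"
proof -
  have sub: "subspace S"
    using S by (rule complex_subspace_imp_subspace)
  obtain p z where p: "p \<in> span S" and z: "\<And>y. y \<in> span S \<Longrightarrow> orthogonal z y" and x: "x = p + z"
    using orthogonal_subspace_decomp_exists by blast
  have span: "span S = S"
    using sub by (simp add: span_eq_iff)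
  have z0: "cinner z y = 0" if y: "y \<in> S" for y
  proof (rule complex_eqI)
    show "Re (cinner z y) = Re 0"
      using z[of y] y span by (simp add: Re_cinner orthogonal_def)
    \<comment> \<open>The real decomposition controls only real parts. Since \<open>S\<close> is
      closed under multiplication by \<open>\<i>\<close>, testing against \<open>\<i> *s y\<close>
      also kills the imaginary part.\<close>
    have "\<i> *s y \<in> S"
      using S y by (simp add: vec.subspace_def)
    then have "Re (cinner z (\<i> *s y)) = 0"
      using z[of "\<i> *s y"] span by (simp add: Re_cinner orthogonal_def)
    then show "Im (cinner z y) = Im 0"
      by (simp add: cinner_scale_right)
  qed
  show ?thesis
  proof (rule ex1I[of _ p])
    show "p \<in> S \<and> (\<forall>y\<in>S. cinner (x - p) y = 0)"
      using p span x z0 by simp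
  next
    fix q assume q: "q \<in> S \<and> (\<forall>y\<in>S. cinner (x - q) y = 0)"
    have mem: "p - q \<in> S"
      using p q sub span by (simp add: subspace_diff)
    have "cinner (p - q) (p - q) = cinner (x - q) (p - q) - cinner z (p - q)"
      using x by (simp flip: cinner_diff_left)
    also have "\<dots> = 0"
      using q mem z0 by simp
    finally show "q = p"
      by (simp add: cinner_self)
  qed
qed

lemma orth_proj_in:
  assumes "vec.subspace S"
  shows "orth_proj S x \<in> S"
  using theI'[OF orth_proj_exists_unique[OF assms, of x]] by (simp add: orth_proj_def)

lemma cinner_orth_proj:
  assumes "vec.subspace S" and y: "y \<in> S"
  shows "cinner y (orth_proj S x) = cinner y x"
proof -
  have "cinner (x - orth_proj S x) y = 0"
    using theI'[OF orth_proj_exists_unique[OF assms(1), of x]] y by (simp add: orth_proj_def)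
  then have "cinner y (x - orth_proj S x) = 0"
    using cnj_cinner by (metis complex_cnj_zero)
  then show ?thesis
    by (simp add: cinner_diff_right)
qed

text \<open>A vanishing projection would make \<open>e i\<close> orthogonal to all of
  \<open>S\<close>, against genericity. This makes the normalisation in \<open>principal_vec\<close>
  meaningful.\<close>

lemma norm_orth_proj_pos:
  assumes "vec.subspace S" and "generic e S"
  shows "0 < norm (orth_proj S (e i))"
proof -
  obtain x where x: "x \<in> S" "cinner x (e i) \<noteq> 0"
    using assms(2) by (auto simp: generic_def coord_def)
  then have "cinner x (orth_proj S (e i)) \<noteq> 0"
    using cinner_orth_proj[OF assms(1)] by simp
  then show ?thesis
    by (auto simp: cinner_def)
qed

lemma principal_vec_in:
  assumes "vec.subspace S"
  shows "principal_vec e S i \<in> S"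
  using orth_proj_in[OF assms] assms
  by (simp add: principal_vec_def scaleR_eq_vec_scale vec.subspace_def)

lemma norm_principal_vec:
  assumes "vec.subspace S" and "generic e S"
  shows "norm (principal_vec e S i) = 1"
  using norm_orth_proj_pos[where i = i, OF assms] by (simp add: principal_vec_def)

text \<open>Vectors of \<open>S\<close> cannot distinguish \<open>e i\<close> from its projection,
  and the projection is its norm times the principal vector.\<close>

lemma coord_eq_cinner_principal_vec:
  assumes "vec.subspace S" and "generic e S" and "x \<in> S"
  shows "coord e x i = of_real (norm (orth_proj S (e i))) * cinner x (principal_vec e S i)"
  using norm_orth_proj_pos[where i = i, OF assms(1,2)] cinner_orth_proj[OF assms(1,3)]
  by (simp add: coord_def principal_vec_def scaleR_eq_vec_scale cinner_scale_right field_simps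
      flip: of_real_inverse)

lemma cinner_bessel_two:
  assumes "norm v = 1" and "norm u = 1" and "cinner v u = 0"
  shows "(norm (cinner x v))\<^sup>2 + (norm (cinner x u))\<^sup>2 \<le> (norm x)\<^sup>2"
proof -
  define \<alpha> \<beta> where "\<alpha> = cinner x v" and "\<beta> = cinner x u"
  have uv: "cinner u v = 0"
    using assms(3) cnj_cinner by (metis complex_cnj_zero)
  have ux: "cinner v x = cnj \<alpha>" "cinner u x = cnj \<beta>"
    by (simp_all add: \<alpha>_def \<beta>_def cnj_cinner)
  \<comment> \<open>Residual of \<open>x\<close> after projecting to the plane of \<open>v\<close>
    and \<open>u\<close>; its squared norm is the gap in the inequality.\<close>
  define z where "z = x - \<alpha> *s v - \<beta> *s u"
  have "cinner z z = cinner x x - \<alpha> * cnj \<alpha> - \<beta> * cnj \<beta>"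
    using assms uv unfolding z_def
    by (simp add: cinner_simps ux cinner_self[of v] cinner_self[of u] algebra_simps
        flip: \<alpha>_def \<beta>_def)
  then have "complex_of_real ((norm z)\<^sup>2)
      = of_real ((norm x)\<^sup>2 - (norm \<alpha>)\<^sup>2 - (norm \<beta>)\<^sup>2)"
    by (simp add: cinner_self complex_norm_square flip: of_real_power)
  then have "(norm z)\<^sup>2 = (norm x)\<^sup>2 - (norm \<alpha>)\<^sup>2 - (norm \<beta>)\<^sup>2"
    using of_real_eq_iff by blast
  then show ?thesis
    using zero_le_power2[of "norm z"] by (simp add: \<alpha>_def \<beta>_def)
qed

section \<open>Ellipses from positive definite quadratic forms\<close>

lemma centred_ellipse_quadratic_form:
  fixes \<alpha> \<beta> \<delta> :: real
  assumes pos: "\<And>x y. (x, y) \<noteq> (0, 0) \<Longrightarrow> 0 < \<alpha> * x\<^sup>2 + 2 * \<beta> * x * y + \<delta> * y\<^sup>2"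
  shows "centred_ellipse {(x, y). \<alpha> * x\<^sup>2 + 2 * \<beta> * x * y + \<delta> * y\<^sup>2 = 1}"
proof -
  \<comment> \<open>In polar coordinates the form is half of
    \<open>(\<alpha> + \<delta>) * r^2\<close> plus half of \<open>r^2\<close> times the real part
    of \<open>z\<close> rotated back by twice the polar angle. A principal axis therefore lies at
    half the argument of \<open>z\<close>.\<close>
  define z where "z = Complex (\<alpha> - \<delta>) (2 * \<beta>)"
  define \<phi> where "\<phi> = Arg z / 2"
  define c s where "c = cos \<phi>" and "s = sin \<phi>"
  have cs: "c\<^sup>2 + s\<^sup>2 = 1"
    by (simp add: c_def s_def)
  have "z = of_real (norm z) * cis (2 * \<phi>)"
    by (simp add: \<phi>_def rcis_cmod_Arg flip: rcis_def)
  then have "\<alpha> - \<delta> = norm z * (c\<^sup>2 - s\<^sup>2)" "2 * \<beta> = norm z * (2 * s * c)"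
    by (simp_all add: z_def complex_eq_iff cos_double sin_double c_def s_def)
  \<comment> \<open>The rotation by half the argument annihilates the mixed term.\<close>
  then have mixed: "(\<alpha> - \<delta>) * (s * c) = \<beta> * (c\<^sup>2 - s\<^sup>2)"
    by algebra
  \<comment> \<open>The values of the form at the unit vectors \<open>(c, s)\<close> and
    \<open>(- s, c)\<close>, that is, its eigenvalues. Their inverse square roots are the
    semi-axes.\<close>
  define l m where "l = \<alpha> * c\<^sup>2 + 2 * \<beta> * c * s + \<delta> * s\<^sup>2"
    and "m = \<alpha> * (- s)\<^sup>2 + 2 * \<beta> * (- s) * c + \<delta> * c\<^sup>2"
  have lm: "0 < l" "0 < m"
    unfolding l_def m_def by (rule pos; use cs in auto)+
  have form: "\<alpha> * x\<^sup>2 + 2 * \<beta> * x * y + \<delta> * y\<^sup>2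
      = (x * c + y * s)\<^sup>2 * l + (x * - s + y * c)\<^sup>2 * m" for x y
    using cs mixed unfolding l_def m_def by algebra
  have "{(x, y). \<alpha> * x\<^sup>2 + 2 * \<beta> * x * y + \<delta> * y\<^sup>2 = 1}
      = {z. (z \<bullet> (c, s))\<^sup>2 / (1 / sqrt l)\<^sup>2 + (z \<bullet> (- s, c))\<^sup>2 / (1 / sqrt m)\<^sup>2 = 1}"
    unfolding form using lm by (auto simp: power_divide)
  moreover have "norm (c, s) = 1" "norm (- s, c) = 1" "(c, s) \<bullet> (- s, c) = 0"
    using cs by (simp_all add: norm_Pair add.commute)
  moreover have "0 < 1 / sqrt l" "0 < 1 / sqrt m"
    using lm by simp_all
  ultimately show ?thesis
    unfolding centred_ellipse_def by blast
qed

section \<open>Extreme points of hypographs\<close>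

lemma extreme_point_of_subset:
  assumes "x extreme_point_of T" and "x \<in> S" and "S \<subseteq> T"
  shows "x extreme_point_of S"
  using assms by (auto simp: extreme_point_of_def)

lemma convex_hypograph:
  fixes f :: "real \<Rightarrow> real"
  assumes "convex A"
    and strict: "\<And>x y u. x \<in> A \<Longrightarrow> y \<in> A \<Longrightarrow> x \<noteq> y \<Longrightarrow> 0 < u \<Longrightarrow> u < 1 \<Longrightarrow>
      (1 - u) * f x + u * f y < f ((1 - u) * x + u * y)"
  shows "convex {(x, y). x \<in> A \<and> y \<le> f x}"
proof -
  have conc: "(1 - u) * f x + u * f y \<le> f ((1 - u) * x + u * y)"
    if "x \<in> A" "y \<in> A" "0 \<le> u" "u \<le> 1" for x y u
  \<comment> \<open>In these degenerate cases equality holds; strict concavity covers the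
    rest.\<close>
  proof (cases "x = y \<or> u = 0 \<or> u = 1")
    case True
    then show ?thesis
      by (auto simp: algebra_simps)
  next
    case False
    then show ?thesis
      using strict[OF that(1,2), of u] that by simp
  qed
  have "(1 - u) * x + u * x' \<in> A \<and> (1 - u) * y + u * y' \<le> f ((1 - u) * x + u * x')"
    if "x \<in> A" "x' \<in> A" "y \<le> f x" "y' \<le> f x'" "0 \<le> u" "u \<le> 1" for x x' y y' u
  proof
    show "(1 - u) * x + u * x' \<in> A"
      using \<open>convex A\<close> that unfolding convex_alt by auto
    have "(1 - u) * y + u * y' \<le> (1 - u) * f x + u * f x'"
      using that by (intro add_mono mult_left_mono) auto
    then show "(1 - u) * y + u * y' \<le> f ((1 - u) * x + u * x')"
      using conc[OF that(1,2,5,6)] by linarith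
  qed
  then show ?thesis
    unfolding convex_alt by auto
qed

text \<open>A segment through a graph point is either vertical, and then both ends lie at or below
  that point and must coincide with it, or it has ends with different abscissas, and strict
  concavity puts its interior strictly below the graph.\<close>

lemma extreme_point_hypograph:
  fixes f :: "real \<Rightarrow> real"
  assumes strict: "\<And>x y u. x \<in> A \<Longrightarrow> y \<in> A \<Longrightarrow> x \<noteq> y \<Longrightarrow> 0 < u \<Longrightarrow> u < 1 \<Longrightarrow>
      (1 - u) * f x + u * f y < f ((1 - u) * x + u * y)"
    and "x \<in> A"
  shows "(x, f x) extreme_point_of {(x, y). x \<in> A \<and> y \<le> f x}"
  unfolding extreme_point_of_def
proof (intro conjI ballI notI)
  show "(x, f x) \<in> {(x, y). x \<in> A \<and> y \<le> f x}"
    using assms(2) by simp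
next
  fix p q
  assume p: "p \<in> {(x, y). x \<in> A \<and> y \<le> f x}" and q: "q \<in> {(x, y). x \<in> A \<and> y \<le> f x}"
    and seg: "(x, f x) \<in> open_segment p q"
  obtain x1 y1 x2 y2 where pq: "p = (x1, y1)" "q = (x2, y2)"
    by (metis prod.exhaust)
  obtain u where u: "0 < u" "u < 1" and ne: "p \<noteq> q"
      and eq: "(x, f x) = (1 - u) *\<^sub>R p + u *\<^sub>R q"
    using seg by (auto simp: in_segment)
  have x: "x = (1 - u) * x1 + u * x2" and y: "f x = (1 - u) * y1 + u * y2"
    using eq pq by auto
  have le: "y1 \<le> f x1" "y2 \<le> f x2" and mem: "x1 \<in> A" "x2 \<in> A"
    using p q pq by auto
  have le': "(1 - u) * y1 \<le> (1 - u) * f x1" "u * y2 \<le> u * f x2"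
    using le u by simp_all
  show False
  proof (cases "x1 = x2")
    case True
    then have "x1 = x"
      using x by (simp add: algebra_simps)
    then have "(1 - u) * (f x - y1) + u * (f x - y2) = 0" "0 \<le> f x - y1" "0 \<le> f x - y2"
      using y le True by (auto simp: algebra_simps)
    then have "y1 = f x" "y2 = f x"
      using u by (auto simp: add_nonneg_eq_0_iff)
    then show ?thesis
      using ne pq True by simp
  next
    case False
    then show ?thesis
      using strict[OF mem False u] le' x y by simp
  qed
qed

text \<open>The graph is an upper half circle through the origin, where a point
  \<open>(x, g)\<close> has squared length \<open>x\<close>. The gap between the squares of the two
  sides is thus \<open>(1 - u) * u\<close> times the squared distance of the two graph
  points.\<close>

lemma half_circle_strictly_concave:
  fixes x y u :: real
  assumes "x \<in> {0..1}" "y \<in> {0..1}" "x \<noteq> y" "0 < u" "u < 1"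
  shows "(1 - u) * sqrt (x * (1 - x)) + u * sqrt (y * (1 - y))
    < sqrt (((1 - u) * x + u * y) * (1 - ((1 - u) * x + u * y)))"
proof (rule real_less_rsqrt)
  define g h where "g = sqrt (x * (1 - x))" and "h = sqrt (y * (1 - y))"
  have sq: "g\<^sup>2 = x * (1 - x)" "h\<^sup>2 = y * (1 - y)"
    using assms by (simp_all add: g_def h_def)
  have "((1 - u) * x + u * y) * (1 - ((1 - u) * x + u * y)) - ((1 - u) * g + u * h)\<^sup>2
      = (1 - u) * u * ((x - y)\<^sup>2 + (g - h)\<^sup>2)"
    using sq by algebra
  moreover have "0 < (1 - u) * u * ((x - y)\<^sup>2 + (g - h)\<^sup>2)"
    using assms by (intro mult_pos_pos add_pos_nonneg) auto
  ultimately show "((1 - u) * g + u * h)\<^sup>2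
      < ((1 - u) * x + u * y) * (1 - ((1 - u) * x + u * y))"
    by linarith
qed

section \<open>The moment and its projection to a plane\<close>

lemma plane_proj_moment_subset:
  assumes "convex H"
    and "\<And>x. x \<in> S \<Longrightarrow> norm x = 1 \<Longrightarrow> ((norm (coord e x j))\<^sup>2, (norm (coord e x k))\<^sup>2) \<in> H"
  shows "plane_proj j k ` moment e S \<subseteq> H"
proof -
  have "linear (plane_proj j k)"
    by (rule linearI) (simp_all add: plane_proj_def)
  \<comment> \<open>Linear maps commute with convex hulls, so only the images of unit vectors have
    to be tested against the convex set \<open>H\<close>.\<close>
  then have "plane_proj j k ` moment e S
      = convex hull (plane_proj j k ` {abs_sq e v | v. v \<in> S \<and> norm v = 1})"
    by (simp add: moment_def convex_hull_linear_image)
  also have "\<dots> \<subseteq> H"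
    using assms by (intro hull_minimal) (auto simp: plane_proj_def abs_sq_def)
  finally show ?thesis .
qed

lemma abs_sq_in_moment: "x \<in> S \<Longrightarrow> norm x = 1 \<Longrightarrow> abs_sq e x \<in> moment e S"
  unfolding moment_def by (rule hull_inc) blast

lemma moment_nonneg: "moment e S \<subseteq> {x. \<forall>l. 0 \<le> x $ l}"
  unfolding moment_def
  by (rule hull_minimal) (auto simp: abs_sq_def convex_alt)

section \<open>Orthogonal decomposition of a pair of principal vectors\<close>

locale principal_pair =
  fixes e :: "'n::finite \<Rightarrow> complex ^ 'n" and S :: "(complex ^ 'n) set" and j k :: 'n
  assumes subspace: "vec.subspace S"
    and generic: "generic e S"
    and indep: "lin_indep_pair (principal_vec e S j) (principal_vec e S k)"
begin

definition "r\<^sub>j = norm (orth_proj S (e j))"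
definition "r\<^sub>k = norm (orth_proj S (e k))"
definition "v\<^sub>j = principal_vec e S j"
definition "v\<^sub>k = principal_vec e S k"
definition "w = v\<^sub>k - cinner v\<^sub>k v\<^sub>j *s v\<^sub>j"
definition "u = w /\<^sub>R norm w"
text \<open>\<open>a\<close> and \<open>b\<close> are the cosine and sine of the angle between the
  complex lines through \<open>v\<^sub>j\<close> and \<open>v\<^sub>k\<close>; see
  \<open>a_b_sq\<close>.\<close>

definition "a = norm (cinner v\<^sub>j v\<^sub>k)"
definition "b = norm w"
text \<open>If the two vectors are orthogonal, the coordinate is 0 and the phase is 1, so it is
  unimodular in every case.\<close>

definition "phase = cis (Arg (coord e v\<^sub>j k))"

lemma r_pos: "0 < r\<^sub>j" "0 < r\<^sub>k"
  unfolding r\<^sub>j_def r\<^sub>k_def by (rule norm_orth_proj_pos[OF subspace generic])+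

lemma v_in: "v\<^sub>j \<in> S" "v\<^sub>k \<in> S"
  unfolding v\<^sub>j_def v\<^sub>k_def by (rule principal_vec_in[OF subspace])+

lemma norm_v: "norm v\<^sub>j = 1" "norm v\<^sub>k = 1"
  unfolding v\<^sub>j_def v\<^sub>k_def by (rule norm_principal_vec[OF subspace generic])+

lemma coord_jk:
  assumes "x \<in> S"
  shows "coord e x j = of_real r\<^sub>j * cinner x v\<^sub>j" "coord e x k = of_real r\<^sub>k * cinner x v\<^sub>k"
  unfolding r\<^sub>j_def r\<^sub>k_def v\<^sub>j_def v\<^sub>k_def
  by (rule coord_eq_cinner_principal_vec[OF subspace generic assms])+

lemma b_pos: "0 < b"
proof -
  have "w \<noteq> 0"
  proof
    assume "w = 0"
    then have "v\<^sub>k = cinner v\<^sub>k v\<^sub>j *s v\<^sub>j"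
      by (simp add: w_def)
    then have "v\<^sub>k \<in> vec.span {v\<^sub>j}"
      by (metis vec.span_base vec.span_scale singletonI)
    moreover have "{v\<^sub>j, v\<^sub>k} - {v\<^sub>k} = {v\<^sub>j}"
      using indep by (auto simp: lin_indep_pair_def v\<^sub>j_def v\<^sub>k_def)
    ultimately have "vec.dependent {v\<^sub>j, v\<^sub>k}"
      unfolding vec.dependent_def by (intro bexI[of _ "v\<^sub>k"]) auto
    then show False
      using indep by (simp add: lin_indep_pair_def v\<^sub>j_def v\<^sub>k_def)
  qed
  then show ?thesis
    by (simp add: b_def)
qed

lemma a_nonneg: "0 \<le> a"
  by (simp add: a_def)

lemma norm_u: "norm u = 1"
  using b_pos by (simp add: u_def b_def)

lemma w_eq: "w = of_real b *s u"
  using b_pos by (simp add: u_def b_def flip: scaleR_eq_vec_scale)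

lemma cinner_w_v: "cinner w v\<^sub>j = 0"
  by (simp add: w_def cinner_simps cinner_self norm_v)

lemma u_orth: "cinner u v\<^sub>j = 0" "cinner v\<^sub>j u = 0"
proof -
  show "cinner u v\<^sub>j = 0"
    using cinner_w_v b_pos by (simp add: w_eq cinner_scale_left)
  then show "cinner v\<^sub>j u = 0"
    using cnj_cinner by (metis complex_cnj_zero)
qed

lemma u_in: "u \<in> S"
proof -
  have "w \<in> S"
    using v_in subspace by (simp add: w_def vec.subspace_diff vec.subspace_scale)
  then show ?thesis
    using subspace by (simp add: u_def scaleR_eq_vec_scale vec.subspace_scale)
qed

lemma v\<^sub>k_eq: "v\<^sub>k = cinner v\<^sub>k v\<^sub>j *s v\<^sub>j + of_real b *s u"
  by (simp add: w_def flip: w_eq)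

text \<open>Conjugate linearity in the second argument turns the coefficient
  \<open>cinner v\<^sub>k v\<^sub>j\<close> of \<open>v\<^sub>k_eq\<close> into
  \<open>cinner v\<^sub>j v\<^sub>k\<close>.\<close>

lemma cinner_v\<^sub>k: "cinner x v\<^sub>k = cinner v\<^sub>j v\<^sub>k * cinner x v\<^sub>j + of_real b * cinner x u"
  by (subst v\<^sub>k_eq) (simp add: cinner_simps cnj_cinner)

lemma cinner_u_v\<^sub>k: "cinner u v\<^sub>k = of_real b"
  using cinner_v\<^sub>k[of u] by (simp add: u_orth cinner_self norm_u)

lemma a_b_sq: "a\<^sup>2 + b\<^sup>2 = 1"
proof -
  have "cinner v\<^sub>k v\<^sub>k = cinner v\<^sub>j v\<^sub>k * cnj (cinner v\<^sub>j v\<^sub>k) + of_real b * cnj (cinner u v\<^sub>k)"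
    using cinner_v\<^sub>k[of v\<^sub>k] by (simp add: cnj_cinner)
  also have "cinner v\<^sub>j v\<^sub>k * cnj (cinner v\<^sub>j v\<^sub>k) = of_real (a\<^sup>2)"
    unfolding a_def by (rule complex_norm_square[symmetric])
  finally have "complex_of_real 1 = of_real (a\<^sup>2 + b\<^sup>2)"
    by (simp add: cinner_u_v\<^sub>k cinner_self norm_v power2_eq_square)
  then show ?thesis
    using of_real_eq_iff by metis
qed

text \<open>The coordinate whose argument enters the curve is the positive multiple
  \<open>r\<^sub>k\<close> of this inner product, so both have the same argument.\<close>

lemma cinner_phase: "cinner v\<^sub>j v\<^sub>k = of_real a * phase"
proof -
  have "of_real r\<^sub>k * cinner v\<^sub>j v\<^sub>k = coord e v\<^sub>j k"
    by (simp add: coord_jk v_in)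
  also have "\<dots> = of_real (norm (coord e v\<^sub>j k)) * phase"
    using rcis_cmod_Arg[of "coord e v\<^sub>j k"] by (simp add: phase_def rcis_def)
  also have "\<dots> = of_real r\<^sub>k * (of_real a * phase)"
    using r_pos by (simp add: coord_jk v_in norm_mult a_def)
  finally show ?thesis
    using r_pos by simp
qed

lemma norm_phase: "norm phase = 1"
  by (simp add: phase_def)

section \<open>The principal curve and its two coordinates\<close>

lemma principal_curve_eq:
  "principal_curve e S j k t = of_real (cos t) *s v\<^sub>j + (of_real (sin t) * phase) *s u"
  by (simp add: principal_curve_def Let_def v\<^sub>j_def v\<^sub>k_def u_def w_def phase_def cis_conv_exp)

lemma principal_curve_in: "principal_curve e S j k t \<in> S"
  using subspace v_in u_in
  by (simp add: principal_curve_eq vec.subspace_add vec.subspace_scale)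

lemma norm_principal_curve: "norm (principal_curve e S j k t) = 1"
proof -
  have "phase * cnj phase = 1"
    using norm_phase by (simp flip: complex_norm_square)
  moreover have "cinner (principal_curve e S j k t) (principal_curve e S j k t)
      = of_real (cos t * cos t) + of_real (sin t * sin t) * (phase * cnj phase)"
    by (simp add: principal_curve_eq cinner_simps u_orth cinner_self[of v\<^sub>j] cinner_self[of u]
        norm_v norm_u)
  ultimately have "cinner (principal_curve e S j k t) (principal_curve e S j k t)
      = of_real (cos t * cos t + sin t * sin t)"
    by (simp only: mult_1_right of_real_add)
  then have "complex_of_real ((norm (principal_curve e S j k t))\<^sup>2) = of_real 1"
    unfolding cinner_self by (simp only: sin_cos_squared_add3)
  then have "(norm (principal_curve e S j k t))\<^sup>2 = 1"
    using of_real_eq_iff by blast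
  then show ?thesis
    using norm_ge_zero[of "principal_curve e S j k t"]
    by (auto simp: power2_eq_1_iff simp del: norm_ge_zero)
qed

lemma coord_principal_curve_j: "coord e (principal_curve e S j k t) j = of_real (r\<^sub>j * cos t)"
  by (simp add: coord_jk principal_curve_in)
    (simp add: principal_curve_eq cinner_simps u_orth cinner_self norm_v)

text \<open>Here the choice of phase pays off: both summands carry the same unimodular factor, so on
  the quarter period their moduli add without cancellation.\<close>

lemma coord_principal_curve_k:
  "coord e (principal_curve e S j k t) k = of_real (r\<^sub>k * (a * cos t + b * sin t)) * phase"
  by (simp add: coord_jk principal_curve_in)
    (simp add: principal_curve_eq cinner_simps cinner_u_v\<^sub>k cinner_phase algebra_simps)

lemma norm_coord_principal_curve:
  assumes "t \<in> {0..pi/2}"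
  shows "norm (coord e (principal_curve e S j k t) j) = r\<^sub>j * cos t"
    and "norm (coord e (principal_curve e S j k t) k) = r\<^sub>k * (a * cos t + b * sin t)"
proof -
  have "0 \<le> cos t" "0 \<le> sin t"
    using assms by (auto intro: cos_ge_zero sin_ge_zero)
  then show "norm (coord e (principal_curve e S j k t) j) = r\<^sub>j * cos t"
    and "norm (coord e (principal_curve e S j k t) k) = r\<^sub>k * (a * cos t + b * sin t)"
    unfolding coord_principal_curve_j coord_principal_curve_k
    using r_pos a_nonneg b_pos by (simp_all only: norm_mult norm_phase norm_of_real) simp_all
qed

section \<open>The upper boundary of the projected moment\<close>

lemma plane_proj_moment_curve:
  assumes "t \<in> {0..pi/2}"
  shows "plane_proj j k (moment_curve e S j k t)
    = ((r\<^sub>j * cos t)\<^sup>2, (r\<^sub>k * (a * cos t + b * sin t))\<^sup>2)"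
  by (simp add: plane_proj_def moment_curve_def abs_sq_def norm_coord_principal_curve[OF assms])

lemma plane_proj_moment_curve_in:
  "plane_proj j k (moment_curve e S j k t) \<in> plane_proj j k ` moment e S"
  unfolding moment_curve_def
  by (intro imageI abs_sq_in_moment principal_curve_in norm_principal_curve)

lemma continuous_moment_curve: "continuous_on A (moment_curve e S j k)"
  unfolding moment_curve_def abs_sq_def principal_curve_eq coord_def cinner_add_left
    cinner_scale_left
  by (intro continuous_intros)

text \<open>With \<open>s = X / r\<^sub>j\<^sup>2\<close> in the unit interval this is the square of
  \<open>r\<^sub>k * (a * sqrt s + b * sqrt (1 - s))\<close>, expanded to show an affine function
  plus a multiple of the half circle.\<close>

definition bound :: "real \<Rightarrow> real" where
  "bound X = r\<^sub>k\<^sup>2 * (a\<^sup>2 * (X / r\<^sub>j\<^sup>2) + b\<^sup>2 * (1 - X / r\<^sub>j\<^sup>2)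
     + 2 * a * b * sqrt (X / r\<^sub>j\<^sup>2 * (1 - X / r\<^sub>j\<^sup>2)))"

lemma unit_vector_under_bound:
  assumes "x \<in> S" and "norm x = 1"
  shows "(norm (coord e x j))\<^sup>2 \<in> {0..r\<^sub>j\<^sup>2}"
    and "(norm (coord e x k))\<^sup>2 \<le> bound ((norm (coord e x j))\<^sup>2)"
proof -
  define \<alpha> \<beta> where "\<alpha> = norm (cinner x v\<^sub>j)" and "\<beta> = norm (cinner x u)"
  have bessel: "\<alpha>\<^sup>2 + \<beta>\<^sup>2 \<le> 1"
    using cinner_bessel_two[OF norm_v(1) norm_u u_orth(2), of x] assms
    by (simp add: \<alpha>_def \<beta>_def)
  then have \<alpha>1: "\<alpha>\<^sup>2 \<le> 1"
    using zero_le_power2[of \<beta>] by linarith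
  have nonneg: "0 \<le> \<alpha>" "0 \<le> \<beta>"
    by (simp_all add: \<alpha>_def \<beta>_def)
  have cj: "norm (coord e x j) = r\<^sub>j * \<alpha>"
    using r_pos assms by (simp add: coord_jk norm_mult \<alpha>_def)
  show "(norm (coord e x j))\<^sup>2 \<in> {0..r\<^sub>j\<^sup>2}"
    using \<alpha>1 mult_left_mono[OF \<alpha>1, of "r\<^sub>j\<^sup>2"] by (simp add: cj power_mult_distrib)
  \<comment> \<open>The largest value that Bessel's inequality permits for \<open>\<beta>\<close>;
    as \<open>b\<close> is positive, replacing \<open>\<beta>\<close> by it only increases the
    estimate.\<close>
  define \<gamma> where "\<gamma> = sqrt (1 - \<alpha>\<^sup>2)"
  have \<gamma>: "\<beta> \<le> \<gamma>" "\<gamma>\<^sup>2 = 1 - \<alpha>\<^sup>2" "0 \<le> \<gamma>"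
    using bessel \<alpha>1 by (simp_all add: \<gamma>_def real_le_rsqrt)
  have "norm (cinner x v\<^sub>k) \<le> a * \<alpha> + b * \<beta>"
    unfolding cinner_v\<^sub>k[of x] a_def \<alpha>_def \<beta>_def
    using b_pos by (intro order.trans[OF norm_triangle_ineq]) (simp add: norm_mult)
  also have "\<dots> \<le> a * \<alpha> + b * \<gamma>"
    using \<gamma> b_pos by simp
  finally have "(norm (cinner x v\<^sub>k))\<^sup>2 \<le> (a * \<alpha> + b * \<gamma>)\<^sup>2"
    by (rule power_mono) simp
  also have "\<dots> = a\<^sup>2 * \<alpha>\<^sup>2 + b\<^sup>2 * (1 - \<alpha>\<^sup>2) + 2 * a * b * (\<alpha> * \<gamma>)"
    by (simp add: power2_sum power_mult_distrib \<gamma>)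
  also have "\<alpha> * \<gamma> = sqrt (\<alpha>\<^sup>2 * (1 - \<alpha>\<^sup>2))"
    using nonneg by (simp add: \<gamma>_def real_sqrt_mult)
  finally have "r\<^sub>k\<^sup>2 * (norm (cinner x v\<^sub>k))\<^sup>2 \<le> bound ((r\<^sub>j * \<alpha>)\<^sup>2)"
    using r_pos by (simp add: bound_def power_mult_distrib)
  then show "(norm (coord e x k))\<^sup>2 \<le> bound ((norm (coord e x j))\<^sup>2)"
    unfolding cj using assms by (simp add: coord_jk norm_mult power_mult_distrib)
qed

text \<open>Cosine and sine are nonnegative on this interval, so the square root in
  \<open>bound\<close> is their product and the expanded square closes up again.\<close>

lemma bound_curve:
  assumes "t \<in> {0..pi/2}"
  shows "bound ((r\<^sub>j * cos t)\<^sup>2) = (r\<^sub>k * (a * cos t + b * sin t))\<^sup>2"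
proof -
  have "0 \<le> cos t" "0 \<le> sin t"
    using assms by (auto intro: cos_ge_zero sin_ge_zero)
  moreover have "1 - (cos t)\<^sup>2 = (sin t)\<^sup>2"
    by (simp add: sin_squared_eq)
  ultimately show ?thesis
    using r_pos by (simp add: bound_def power_mult_distrib real_sqrt_mult power2_sum)
qed

text \<open>The affine part contributes equality; the half circle has the factor
  \<open>2 * a * b * r\<^sub>k\<^sup>2\<close>, positive because \<open>a\<close> is
  nonzero.\<close>

lemma bound_strictly_concave:
  assumes "a \<noteq> 0" and "x \<in> {0..r\<^sub>j\<^sup>2}" "y \<in> {0..r\<^sub>j\<^sup>2}" "x \<noteq> y" "0 < s" "s < 1"
  shows "(1 - s) * bound x + s * bound y < bound ((1 - s) * x + s * y)"
proof -
  define x' y' where "x' = x / r\<^sub>j\<^sup>2" and "y' = y / r\<^sub>j\<^sup>2"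
  have xy: "x' \<in> {0..1}" "y' \<in> {0..1}" "x' \<noteq> y'"
    using assms r_pos by (simp_all add: x'_def y'_def field_simps)
  define z' where "z' = (1 - s) * x' + s * y'"
  have z': "((1 - s) * x + s * y) / r\<^sub>j\<^sup>2 = z'"
    by (simp add: z'_def x'_def y'_def add_divide_distrib)
  have "0 < r\<^sub>k\<^sup>2 * (2 * a * b)"
    using assms(1) a_nonneg b_pos r_pos by simp
  then have "r\<^sub>k\<^sup>2 * (2 * a * b) * ((1 - s) * sqrt (x' * (1 - x')) + s * sqrt (y' * (1 - y')))
      < r\<^sub>k\<^sup>2 * (2 * a * b) * sqrt (z' * (1 - z'))"
    unfolding z'_def using half_circle_strictly_concave[OF xy assms(5,6)]
    by (rule mult_strict_left_mono[rotated])
  then show ?thesis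
    unfolding bound_def z' x'_def[symmetric] y'_def[symmetric]
    by (simp add: algebra_simps) (simp add: z'_def algebra_simps)
qed

section \<open>Non-orthogonal pairs: extreme points\<close>

lemma moment_curve_extreme:
  assumes "a \<noteq> 0" and t: "t \<in> {0..pi/2}"
  shows "plane_proj j k (moment_curve e S j k t) extreme_point_of plane_proj j k ` moment e S"
proof -
  \<comment> \<open>The hypograph of \<open>bound\<close> is convex and contains the whole projected
    moment. The curve lies on its graph, and extremality in \<open>?H\<close> passes to any subset
    containing the point.\<close>
  let ?H = "{(x, y). x \<in> {0..r\<^sub>j\<^sup>2} \<and> y \<le> bound x}"
  have sub: "plane_proj j k ` moment e S \<subseteq> ?H"
    using convex_hypograph[OF convex_real_interval(5) bound_strictly_concave[OF assms(1)]]
      unit_vector_under_bound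
    by (intro plane_proj_moment_subset) auto
  have "plane_proj j k (moment_curve e S j k t)
      = ((r\<^sub>j * cos t)\<^sup>2, bound ((r\<^sub>j * cos t)\<^sup>2))"
    by (simp add: plane_proj_moment_curve[OF t] bound_curve[OF t])
  moreover have "(r\<^sub>j * cos t)\<^sup>2 \<in> {0..r\<^sub>j\<^sup>2}"
    using sub plane_proj_moment_curve_in[of t] plane_proj_moment_curve[OF t] by auto
  then have "((r\<^sub>j * cos t)\<^sup>2, bound ((r\<^sub>j * cos t)\<^sup>2)) extreme_point_of ?H"
    by (rule extreme_point_hypograph[rotated]) (rule bound_strictly_concave[OF assms(1)])
  ultimately have "plane_proj j k (moment_curve e S j k t) extreme_point_of ?H"
    by simp
  then show ?thesis
    using plane_proj_moment_curve_in sub by (rule extreme_point_of_subset)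
qed

section \<open>Orthogonal pairs: a segment in the boundary\<close>

lemma moment_curve_segment:
  assumes "a = 0"
  shows "(\<lambda>t. plane_proj j k (moment_curve e S j k t)) ` {0..pi/2}
    = closed_segment (r\<^sub>j\<^sup>2, 0) (0, r\<^sub>k\<^sup>2)"
proof -
  have b: "b = 1"
    using a_b_sq assms b_pos by (simp add: power2_eq_1_iff)
  \<comment> \<open>With \<open>a = 0\<close> and \<open>b = 1\<close> the squared moduli are affine
    in the square of \<open>sin t\<close>, which serves as the segment parameter.\<close>
  have pt: "plane_proj j k (moment_curve e S j k t)
      = (1 - (sin t)\<^sup>2) *\<^sub>R (r\<^sub>j\<^sup>2, 0) + (sin t)\<^sup>2 *\<^sub>R (0, r\<^sub>k\<^sup>2)" if "t \<in> {0..pi/2}" for t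
    using that by (simp add: plane_proj_moment_curve assms b power_mult_distrib cos_squared_eq)
  show ?thesis
  proof (intro equalityI subsetI)
    fix p assume "p \<in> (\<lambda>t. plane_proj j k (moment_curve e S j k t)) ` {0..pi/2}"
    then obtain t where "t \<in> {0..pi/2}" "p = plane_proj j k (moment_curve e S j k t)"
      by blast
    then show "p \<in> closed_segment (r\<^sub>j\<^sup>2, 0) (0, r\<^sub>k\<^sup>2)"
      unfolding in_segment using pt by (intro exI[of _ "(sin t)\<^sup>2"]) (simp add: abs_square_le_1)
  next
    fix p assume "p \<in> closed_segment (r\<^sub>j\<^sup>2, 0) (0, r\<^sub>k\<^sup>2)"
    then obtain s where s: "0 \<le> s" "s \<le> 1"
        and p: "p = (1 - s) *\<^sub>R (r\<^sub>j\<^sup>2, 0) + s *\<^sub>R (0, r\<^sub>k\<^sup>2)"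
      by (auto simp: in_segment)
    \<comment> \<open>Solves for the time in the quarter period at which the square of
      \<open>sin t\<close> equals \<open>s\<close>.\<close>
    define t where "t = arcsin (sqrt s)"
    have sqrt_s: "0 \<le> sqrt s" "sqrt s \<le> 1"
      using s by simp_all
    then have ge: "- 1 \<le> sqrt s"
      by linarith
    have t: "t \<in> {0..pi/2}" "sin t = sqrt s"
      using sqrt_s ge arcsin_le_arcsin[of 0 "sqrt s"] arcsin_ubound[OF ge sqrt_s(2)]
        sin_arcsin[OF ge sqrt_s(2)]
      by (simp_all add: t_def)
    then have "p = plane_proj j k (moment_curve e S j k t)"
      using s by (simp add: pt p)
    then show "p \<in> (\<lambda>t. plane_proj j k (moment_curve e S j k t)) ` {0..pi/2}"
      using t by blast
  qed
qed

text \<open>For \<open>a = 0\<close> the bound is affine and says that the projection lies in a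
  half-plane with normal \<open>n\<close>. The segment lies on the bounding line, so none of its
  points is interior.\<close>

lemma segment_in_frontier:
  assumes "a = 0"
  shows "closed_segment (r\<^sub>j\<^sup>2, 0) (0, r\<^sub>k\<^sup>2) \<subseteq> frontier (plane_proj j k ` moment e S)"
proof
  fix p assume p: "p \<in> closed_segment (r\<^sub>j\<^sup>2, 0) (0, r\<^sub>k\<^sup>2)"
  define n where "n = (1 / r\<^sub>j\<^sup>2, 1 / r\<^sub>k\<^sup>2)"
  have b: "b = 1"
    using a_b_sq assms b_pos by (simp add: power2_eq_1_iff)
  have "plane_proj j k ` moment e S \<subseteq> {x. n \<bullet> x \<le> 1}"
  proof (rule plane_proj_moment_subset)
    fix x assume "x \<in> S" "norm x = 1"
    from unit_vector_under_bound(2)[OF this]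
    show "((norm (coord e x j))\<^sup>2, (norm (coord e x k))\<^sup>2) \<in> {x. n \<bullet> x \<le> 1}"
      using r_pos by (simp add: bound_def assms b n_def field_simps)
  qed (rule convex_halfspace_le)
  then have "interior (plane_proj j k ` moment e S) \<subseteq> {x. n \<bullet> x < 1}"
    using interior_mono[of "plane_proj j k ` moment e S" "{x. n \<bullet> x \<le> 1}"] r_pos
    by (simp add: interior_halfspace_le n_def zero_prod_def)
  moreover have "n \<bullet> p = 1"
    using p r_pos by (auto simp: in_segment n_def)
  moreover have "p \<in> plane_proj j k ` moment e S"
    using p plane_proj_moment_curve_in by (auto simp flip: moment_curve_segment[OF assms])
  ultimately show "p \<in> frontier (plane_proj j k ` moment e S)"
    using closure_subset[of "plane_proj j k ` moment e S"] by (auto simp: frontier_def)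
qed

section \<open>The ellipse traced by the moduli\<close>

lemma moment_curve_ellipse:
  "\<exists>C. centred_ellipse C \<and>
    (\<lambda>t. (norm (coord e (principal_curve e S j k t) j),
          norm (coord e (principal_curve e S j k t) k))) ` {0..pi/2} \<subseteq> C"
proof -
  \<comment> \<open>Eliminating \<open>t\<close> from \<open>x = r\<^sub>j cos t\<close>, \<open>y = r\<^sub>k (a cos t + b sin t)\<close>:
    \<open>(x / r\<^sub>j)\<^sup>2 + ((y / r\<^sub>k - a x / r\<^sub>j) / b)\<^sup>2 = 1\<close>, simplified by \<open>a\<^sup>2 + b\<^sup>2 = 1\<close>.\<close>
  define \<alpha> \<beta> \<delta> where "\<alpha> = 1 / (r\<^sub>j * b)\<^sup>2" and "\<beta> = - a / (r\<^sub>j * r\<^sub>k * b\<^sup>2)"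
    and "\<delta> = 1 / (r\<^sub>k * b)\<^sup>2"
  have form: "\<alpha> * x\<^sup>2 + 2 * \<beta> * x * y + \<delta> * y\<^sup>2
      = (x / r\<^sub>j)\<^sup>2 + ((y / r\<^sub>k - a * (x / r\<^sub>j)) / b)\<^sup>2" for x y
  proof -
    define x' y' where "x' = x / r\<^sub>j" and "y' = y / r\<^sub>k"
    have "\<alpha> * x\<^sup>2 + 2 * \<beta> * x * y + \<delta> * y\<^sup>2 = (x'\<^sup>2 - 2 * a * x' * y' + y'\<^sup>2) / b\<^sup>2"
      using r_pos b_pos
      by (simp add: \<alpha>_def \<beta>_def \<delta>_def x'_def y'_def field_simps power2_eq_square)
    also have "x'\<^sup>2 - 2 * a * x' * y' + y'\<^sup>2 = b\<^sup>2 * x'\<^sup>2 + (y' - a * x')\<^sup>2"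
      using a_b_sq by algebra
    finally show ?thesis
      using b_pos by (simp add: x'_def y'_def add_divide_distrib power_divide)
  qed
  have "centred_ellipse {(x, y). \<alpha> * x\<^sup>2 + 2 * \<beta> * x * y + \<delta> * y\<^sup>2 = 1}"
  proof (rule centred_ellipse_quadratic_form)
    fix x y :: real
    assume ne: "(x, y) \<noteq> (0, 0)"
    show "0 < \<alpha> * x\<^sup>2 + 2 * \<beta> * x * y + \<delta> * y\<^sup>2"
      \<comment> \<open>Of the two squares the first is positive if \<open>x\<close> is nonzero;
        otherwise \<open>y\<close> is nonzero and the second is.\<close>
      unfolding form using ne r_pos b_pos
      by (cases "x = 0") (auto intro: add_pos_nonneg)
  qed
  moreover have "(norm (coord e (principal_curve e S j k t) j),
      norm (coord e (principal_curve e S j k t) k))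
      \<in> {(x, y). \<alpha> * x\<^sup>2 + 2 * \<beta> * x * y + \<delta> * y\<^sup>2 = 1}" if "t \<in> {0..pi/2}" for t
    unfolding form norm_coord_principal_curve[OF that] using r_pos b_pos by simp
  ultimately show ?thesis
    by blast
qed

end

theorem theorem5p6:
  fixes e :: "'n::finite \<Rightarrow> complex ^ 'n"
    and S :: "(complex ^ 'n) set"
    and j k :: 'n
  assumes "orthonormal_basis e"
    and "vec.subspace S" and "S \<noteq> {0}" and "S \<noteq> UNIV"
    and "generic e S"
    and "lin_indep_pair (principal_vec e S j) (principal_vec e S k)"
  shows
    "(continuous_on {0..pi/2} (moment_curve e S j k)
      \<and> moment_curve e S j k ` {0..pi/2} \<subseteq> moment e S
      \<and> moment e S \<subseteq> {x. \<forall>l. 0 \<le> x $ l})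
    \<and>
     ((\<forall>t\<in>{0..pi/2}. plane_proj j k (\<chi> l. sqrt (moment_curve e S j k t $ l))
         = (norm (coord e (principal_curve e S j k t) j),
            norm (coord e (principal_curve e S j k t) k)))
      \<and> (\<exists>C. centred_ellipse C \<and>
           (\<lambda>t. plane_proj j k (\<chi> l. sqrt (moment_curve e S j k t $ l))) ` {0..pi/2} \<subseteq> C))
    \<and>
     (cinner (principal_vec e S j) (principal_vec e S k) \<noteq> 0 \<longrightarrow>
      (\<forall>t\<in>{0..pi/2}. plane_proj j k (moment_curve e S j k t)
         extreme_point_of (plane_proj j k ` moment e S)))
    \<and>
     (cinner (principal_vec e S j) (principal_vec e S k) = 0 \<longrightarrow>
      (\<exists>a b. a \<noteq> b
        \<and> (\<lambda>t. plane_proj j k (moment_curve e S j k t)) ` {0..pi/2} = closed_segment a b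
        \<and> closed_segment a b \<subseteq> frontier (plane_proj j k ` moment e S)))"
proof -
  interpret principal_pair e S j k
    using assms by unfold_locales
  have sqrt_eq: "plane_proj j k (\<chi> l. sqrt (moment_curve e S j k t $ l))
      = (norm (coord e (principal_curve e S j k t) j),
         norm (coord e (principal_curve e S j k t) k))" for t
    by (simp add: plane_proj_def moment_curve_def abs_sq_def)
  have a0: "cinner (principal_vec e S j) (principal_vec e S k) = 0 \<longleftrightarrow> a = 0"
    by (simp add: a_def v\<^sub>j_def v\<^sub>k_def)
  have "moment_curve e S j k ` {0..pi/2} \<subseteq> moment e S"
    by (auto simp: moment_curve_def intro: abs_sq_in_moment principal_curve_in norm_principal_curve)
  moreover have "\<exists>p q. p \<noteq> q
        \<and> (\<lambda>t. plane_proj j k (moment_curve e S j k t)) ` {0..pi/2} = closed_segment p q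
        \<and> closed_segment p q \<subseteq> frontier (plane_proj j k ` moment e S)" if "a = 0"
    using moment_curve_segment[OF that] segment_in_frontier[OF that] r_pos
    by (intro exI[of _ "(r\<^sub>j\<^sup>2, 0)"] exI[of _ "(0, r\<^sub>k\<^sup>2)"]) simp
  ultimately show ?thesis
    unfolding sqrt_eq a0
    using continuous_moment_curve moment_nonneg moment_curve_ellipse moment_curve_extreme
    by (intro conjI impI ballI) simp_all
qed

end
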